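(* For every $n\ge5$, the length of a longest induced path in $G_n$ is $6$.
   Context: Graph $G_n$: let $X=\{u_0,\dots,u_{n-1}\}$ and $Y=\{v_0,\dots,v_{n-1}\}$ be disjoint, indices modulo $n$. $G_n$ is the bipartite graph on $X\sqcup Y$ with $\{u_i,v_j\}\in E(G_n)$ iff $j\notin\{i,i-1\}$ modulo $n$ (the bipartite complement of the cycle $C_{2n}$ with edges $\{u_i,v_i\},\{u_i,v_{i-1}\}$). The length of a path is its number of edges (a path on $r$ vertices has length $r-1$); an induced path is an induced subgraph that is a path. *)

theory Defs
  imports Main "HOL-Number_Theory.Cong"
begin

record 'a ugraph =
  verts :: "'a set"
  edges :: "'a set set"

definition induced_subgraph :: "'a ugraph \<Rightarrow> 'a set \<Rightarrow> 'a ugraph" where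
  "induced_subgraph G S = \<lparr>verts = S, edges = {e \<in> edges G. e \<subseteq> S}\<rparr>"

definition is_path :: "'a ugraph \<Rightarrow> bool" where
  "is_path P \<longleftrightarrow> (\<exists>xs. xs \<noteq> [] \<and> distinct xs \<and> verts P = set xs \<and>
     edges P = {{xs ! i, xs ! Suc i} | i. Suc i < length xs})"

definition induced_path :: "'a ugraph \<Rightarrow> 'a ugraph \<Rightarrow> bool" where
  "induced_path G P \<longleftrightarrow> is_path P \<and> (\<exists>S \<subseteq> verts G. P = induced_subgraph G S)"

definition path_length :: "'a ugraph \<Rightarrow> nat" where
  "path_length P = card (edges P)"

definition longest_induced_path_length :: "'a ugraph \<Rightarrow> nat" where
  "longest_induced_path_length G = Max (path_length ` {P. induced_path G P})"

text \<open>For a nonempty finite graph whose edges are two-element sets, the maximum ranges over a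
  nonempty finite set, hence is attained.\<close>

lemma finite_induced_paths:
  assumes "finite (verts G)"
  shows "finite {P. induced_path G P}"
proof (rule finite_subset)
  show "{P. induced_path G P} \<subseteq> induced_subgraph G ` Pow (verts G)"
    by (auto simp: induced_path_def)
  show "finite (induced_subgraph G ` Pow (verts G))"
    using assms by simp
qed

lemma induced_path_singleton:
  assumes "v \<in> verts G" and "\<And>e. e \<in> edges G \<Longrightarrow> card e = 2"
  shows "induced_path G (induced_subgraph G {v})"
proof -
  have "{e \<in> edges G. e \<subseteq> {v}} = {}"
    using assms(2) by (fastforce dest: subset_singletonD)
  then have "is_path (induced_subgraph G {v})"
    unfolding is_path_def induced_subgraph_def by (intro exI[of _ "[v]"]) simp
  with assms(1) show ?thesis
    unfolding induced_path_def by blast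
qed

datatype vertex = U nat | V nat

text \<open>The indices are the representatives \<open>0, \<dots>, n - 1\<close>; congruences are taken over the integers
  so that \<open>i - 1\<close> is not truncated.\<close>

definition graph_G :: "nat \<Rightarrow> vertex ugraph" where
  "graph_G n = \<lparr>verts = U ` {..<n} \<union> V ` {..<n},
          edges = {{U i, V j} | i j. i < n \<and> j < n \<and>
            \<not> [int j = int i] (mod int n) \<and> \<not> [int j = int i - 1] (mod int n)}\<rparr>"

lemma card_edge_graph_G: "e \<in> edges (graph_G n) \<Longrightarrow> card e = 2"
  by (auto simp: graph_G_def)

lemma finite_verts_graph_G: "finite (verts (graph_G n))"
  by (simp add: graph_G_def)

end

theory Submission
  imports Defs
begin

text \<open>
  Two vertices on opposite sides of \<open>G_n\<close> are non-adjacent exactly if they are adjacent in the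
  cycle \<open>C_{2n}\<close>, so every vertex has at most two non-neighbours on the opposite side
  (\<open>opposite_nonneighbours\<close>). If an induced path had eight vertices
  \<open>p_0, \<dots>, p_7\<close>, then \<open>p_0\<close> would have the three non-neighbours \<open>p_3\<close>, \<open>p_5\<close>, \<open>p_7\<close>, which lie
  on the opposite side because edges change sides. Hence an induced path has at most seven vertices
  (\<open>induced_path_at_most_7_vertices\<close>).

  Seven vertices are possible because the path on seven vertices is its own bipartite complement:
  in \<open>p_0, \<dots>, p_6\<close> the non-adjacent pairs of opposite parity are exactly the consecutive pairs of
  the sequence \<open>p_4, p_1, p_6, p_3, p_0, p_5, p_2\<close>. Labelling by this sequence seven consecutive
  vertices \<open>u_0, v_0, u_1, v_1, u_2, v_2, u_3\<close> of \<open>C_{2n}\<close>, which induce a path there as \<open>n \<ge> 5\<close>,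
  gives an induced path of length six in \<open>G_n\<close> (\<open>induced_path_with_7_vertices\<close>).
\<close>

primrec left_side :: "vertex \<Rightarrow> bool" where
  "left_side (U i) = True"
| "left_side (V j) = False"

lemma edge_graph_G_iff:
  "{U i, V j} \<in> edges (graph_G n) \<longleftrightarrow> i < n \<and> j < n \<and> j \<noteq> i \<and> Suc j mod n \<noteq> i"
proof -
  have "[int j = int i] (mod int n) \<longleftrightarrow> j = i" if "i < n" "j < n"
    using that by (simp add: cong_int_iff cong_def)
  moreover have "[int j = int i - 1] (mod int n) \<longleftrightarrow> Suc j mod n = i" if "i < n" "j < n"
  proof -
    have "[int j = int i - 1] (mod int n) \<longleftrightarrow> [int j + 1 = int i - 1 + 1] (mod int n)"
      by (rule cong_add_rcancel[symmetric])
    also have "\<dots> \<longleftrightarrow> [int (Suc j) = int i] (mod int n)"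
      by (simp add: add.commute)
    also have "\<dots> \<longleftrightarrow> Suc j mod n = i"
      using that by (simp only: cong_int_iff) (simp add: cong_def)
    finally show ?thesis .
  qed
  ultimately show ?thesis
    by (auto simp: graph_G_def doubleton_eq_iff)
qed

lemma edge_graph_G_iff':
  "{V j, U i} \<in> edges (graph_G n) \<longleftrightarrow> i < n \<and> j < n \<and> j \<noteq> i \<and> Suc j mod n \<noteq> i"
  using edge_graph_G_iff[of i j n] by (simp add: insert_commute)

lemma edge_changes_side:
  "{x, y} \<in> edges (graph_G n) \<Longrightarrow> left_side y \<longleftrightarrow> \<not> left_side x"
  by (auto simp: graph_G_def doubleton_eq_iff)

text \<open>The bound is the degree of a vertex in the cycle: the two candidates are the predecessor and the
  successor of \<open>x\<close> on \<open>C_{2n}\<close>.\<close>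

lemma opposite_nonneighbours:
  fixes n :: nat and x :: vertex
  defines "N \<equiv> {y \<in> verts (graph_G n). left_side y \<noteq> left_side x \<and> {x, y} \<notin> edges (graph_G n)}"
  assumes "x \<in> verts (graph_G n)"
  shows "card N \<le> 2"
proof (cases x)
  case (U i)
  with assms have "i < n"
    by (auto simp: graph_G_def)
  have "N \<subseteq> {V i, V ((i + n - 1) mod n)}"
  proof
    fix y assume "y \<in> N"
    then obtain j where y: "y = V j" and j: "j < n" and "j = i \<or> Suc j mod n = i"
      using U \<open>i < n\<close> by (cases y) (auto simp: N_def edge_graph_G_iff, auto simp: graph_G_def)
    moreover have "j = (i + n - 1) mod n" if "Suc j mod n = i"
      using that j by (cases "Suc j = n") auto
    ultimately show "y \<in> {V i, V ((i + n - 1) mod n)}"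
      by auto
  qed
  from card_mono[OF _ this] show ?thesis
    by (simp add: card_insert_if split: if_splits)
next
  case (V j)
  with assms have "j < n"
    by (auto simp: graph_G_def)
  have "N \<subseteq> {U j, U (Suc j mod n)}"
  proof
    fix y assume "y \<in> N"
    then show "y \<in> {U j, U (Suc j mod n)}"
      using V \<open>j < n\<close>
      by (cases y) (auto simp: N_def edge_graph_G_iff', auto simp: graph_G_def)
  qed
  from card_mono[OF _ this] show ?thesis
    by (simp add: card_insert_if split: if_splits)
qed

lemma path_edge_iff:
  assumes "distinct xs" "i < length xs" "j < length xs"
  shows "{xs ! i, xs ! j} \<in> {{xs ! k, xs ! Suc k} | k. Suc k < length xs} \<longleftrightarrow> j = Suc i \<or> i = Suc j"
  using assms by (auto simp: doubleton_eq_iff nth_eq_iff_index_eq)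

lemma path_edges_eq_image:
  "{{xs ! k, xs ! Suc k} | k. Suc k < length xs} = (\<lambda>k. {xs ! k, xs ! Suc k}) ` {..<length xs - 1}"
  by (auto simp: less_diff_conv)

lemma card_path_edges:
  assumes "distinct xs"
  shows "card {{xs ! k, xs ! Suc k} | k. Suc k < length xs} = length xs - 1"
proof -
  have "inj_on (\<lambda>k. {xs ! k, xs ! Suc k}) {..<length xs - 1}"
    using assms by (auto simp: inj_on_def doubleton_eq_iff nth_eq_iff_index_eq)
  then show ?thesis
    by (simp add: path_edges_eq_image card_image)
qed

text \<open>The positions 3, 5 and 7 have the parity opposite to 0 without being adjacent to it on the path,
  so with eight vertices the initial one would exceed the bound on non-neighbours.\<close>

lemma induced_path_at_most_7_vertices:
  assumes dist: "distinct xs" and sub: "set xs \<subseteq> verts (graph_G n)"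
    and path: "{e \<in> edges (graph_G n). e \<subseteq> set xs} = {{xs ! k, xs ! Suc k} | k. Suc k < length xs}"
  shows "length xs \<le> 7"
proof (rule ccontr)
  assume "\<not> length xs \<le> 7"
  then have len: "8 \<le> length xs" by simp
  have edge: "{xs ! i, xs ! j} \<in> edges (graph_G n) \<longleftrightarrow> j = Suc i \<or> i = Suc j"
    if "i < length xs" "j < length xs" for i j
    using path_edge_iff[OF dist that] that unfolding path[symmetric] by auto
  have side: "left_side (xs ! k) \<longleftrightarrow> (left_side (xs ! 0) \<longleftrightarrow> even k)" if "k < length xs" for k
    using that
  proof (induction k)
    case (Suc k)
    then show ?case
      using edge_changes_side[of "xs ! k" "xs ! Suc k"] edge[of k "Suc k"] by auto
  qed simp
  let ?N = "{y \<in> verts (graph_G n).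
    left_side y \<noteq> left_side (xs ! 0) \<and> {xs ! 0, y} \<notin> edges (graph_G n)}"
  have "xs ! k \<in> ?N" if "k \<in> {3, 5, 7}" for k
  proof -
    have "k < length xs" "0 < length xs" "odd k" "k \<noteq> Suc 0"
      using that len by auto
    moreover from this have "xs ! k \<in> verts (graph_G n)"
      using sub nth_mem by blast
    ultimately show ?thesis
      using side[of k] edge[of 0 k] by auto
  qed
  then have "(!) xs ` {3, 5, 7} \<subseteq> ?N"
    by blast
  moreover have "finite ?N"
    using finite_verts_graph_G by simp
  ultimately have "card ((!) xs ` {3, 5, 7}) \<le> card ?N"
    by (rule card_mono[rotated])
  moreover have "inj_on ((!) xs) {3, 5, 7}"
    using len dist by (intro inj_on_nth) auto
  then have "card ((!) xs ` {3, 5, 7}) = 3"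
    by (simp add: card_image)
  moreover have "xs ! 0 \<in> verts (graph_G n)"
    using sub len nth_mem[of 0 xs] by fastforce
  ultimately show False
    using opposite_nonneighbours[of "xs ! 0" n] by simp
qed

lemma induced_path_with_7_vertices:
  assumes "n \<ge> 5"
  shows "\<exists>P. induced_path (graph_G n) P \<and> path_length P = 6"
proof -
  \<comment> \<open>Read in the order of the positions 4, 1, 6, 3, 0, 5, 2, this list runs along the cycle as
    \<open>u_0, v_0, u_1, v_1, u_2, v_2, u_3\<close>.\<close>
  define xs where "xs = [U 2, V 0, U 3, V 1, U 0, V 2, U 1]"
  have dist: "distinct xs"
    by (simp add: xs_def)
  have path: "{{xs ! k, xs ! Suc k} | k. Suc k < length xs} =
      {{U 2, V 0}, {U 3, V 0}, {U 3, V 1}, {U 0, V 1}, {U 0, V 2}, {U 1, V 2}}"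
    (is "?L = ?R")
    unfolding path_edges_eq_image
    by (simp add: xs_def lessThan_nat_numeral lessThan_Suc insert_commute)
  have edges: "{e \<in> edges (graph_G n). e \<subseteq> set xs} = ?R"
  proof
    show "{e \<in> edges (graph_G n). e \<subseteq> set xs} \<subseteq> ?R"
    proof
      fix e assume e: "e \<in> {e \<in> edges (graph_G n). e \<subseteq> set xs}"
      then obtain i j where ij: "e = {U i, V j}"
        by (auto simp: graph_G_def)
      with e have "i \<in> {0, 1, 2, 3}" "j \<in> {0, 1, 2}" "j \<noteq> i" "Suc j mod n \<noteq> i"
        by (auto simp: xs_def edge_graph_G_iff)
      \<comment> \<open>Here \<open>j \<le> 2\<close>, so the indices do not wrap around.\<close>
      moreover from this have "Suc j mod n = Suc j"
        using assms by (intro mod_less) auto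
      ultimately have "(i, j) \<in> {(2, 0), (3, 0), (3, 1), (0, 1), (0, 2), (1, 2)}"
        by auto
      then show "e \<in> ?R"
        unfolding ij by (elim insertE emptyE) simp_all
    qed
    show "?R \<subseteq> {e \<in> edges (graph_G n). e \<subseteq> set xs}"
      using assms by (simp add: xs_def edge_graph_G_iff)
  qed
  let ?P = "induced_subgraph (graph_G n) (set xs)"
  have edges_P: "edges ?P = {{xs ! k, xs ! Suc k} | k. Suc k < length xs}"
    using edges path by (simp only: induced_subgraph_def ugraph.simps)
  have "set xs \<subseteq> verts (graph_G n)"
    using assms by (auto simp: xs_def graph_G_def)
  moreover have "is_path ?P"
    unfolding is_path_def
  proof (rule exI[of _ xs], intro conjI)
    show "xs \<noteq> []" by (simp add: xs_def)
    show "verts ?P = set xs" by (simp add: induced_subgraph_def)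
    show "distinct xs" by (rule dist)
    show "edges ?P = {{xs ! k, xs ! Suc k} | k. Suc k < length xs}" by (rule edges_P)
  qed
  moreover have "path_length ?P = 6"
    unfolding path_length_def using card_path_edges[OF dist, folded edges_P]
    by (rule trans) (simp add: xs_def)
  ultimately show ?thesis
    unfolding induced_path_def by blast
qed

theorem proposition7p1:
  fixes n :: nat
  assumes "n \<ge> 5"
  shows "longest_induced_path_length (graph_G n) = 6"
  unfolding longest_induced_path_length_def
proof (rule Max_eqI)
  show "finite (path_length ` {P. induced_path (graph_G n) P})"
    by (intro finite_imageI finite_induced_paths finite_verts_graph_G)
  show "6 \<in> path_length ` {P. induced_path (graph_G n) P}"
    using induced_path_with_7_vertices[OF assms] by force
  fix l assume "l \<in> path_length ` {P. induced_path (graph_G n) P}"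
  then obtain P where P: "induced_path (graph_G n) P" and l: "l = path_length P"
    by blast
  from P obtain S xs where "S \<subseteq> verts (graph_G n)" and "P = induced_subgraph (graph_G n) S"
    and dist: "distinct xs" and "verts P = set xs"
    and edges: "edges P = {{xs ! k, xs ! Suc k} | k. Suc k < length xs}"
    unfolding induced_path_def is_path_def by blast
  then have "length xs \<le> 7"
    by (intro induced_path_at_most_7_vertices) (auto simp: induced_subgraph_def)
  then show "l \<le> 6"
    unfolding l path_length_def edges card_path_edges[OF dist] by simp
qed

end
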